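(* Let $(X,d)$ be a metric space, let $f : X \to X$ be a homeomorphism, and let $c \in \mathbb{R}$, $c>0$. Then $f$ is nonstandard expansive with constant of expansivity $c$ if and only if for all $x, y \in X$ with $x \neq y$ the set $\{ n \in \mathbb{Z} : d(f^n(x), f^n(y)) > c \}$ is infinite.
   Context: Fix a nonstandard extension ${}^*$ (for instance an ultrapower by a free ultrafilter on $\mathbb{N}$) satisfying the transfer principle, with ${}^*\mathbb{N} \neq \mathbb{N}$. Thus there are nonstandard extensions ${}^*X$, ${}^*\mathbb{R}$, ${}^*\mathbb{Z}$, ${}^*\mathbb{N}$, ${}^*d : {}^*X \times {}^*X \to {}^*\mathbb{R}$ and ${}^*f : {}^*X \to {}^*X$; standard elements are identified with their images. For $n \in {}^*\mathbb{Z}$, the iterate $({}^*f)^n : {}^*X \to {}^*X$ is given by the nonstandard extension of the map $\mathbb{Z} \times X \to X$, $(n,x) \mapsto f^n(x)$. Write ${}^*\mathbb{Z}_\infty = {}^*\mathbb{Z} \setminus \mathbb{Z}$ for the set of infinite elements of ${}^*\mathbb{Z}$. Definition. A homeomorphism $f : X \to X$ is nonstandard expansive with constant of expansivity $c$ ($c \in \mathbb{R}$, $c>0$) if for all $x,y \in X$ with $x \neq y$ there exists $n \in {}^*\mathbb{Z}_\infty$ such that ${}^*d(({}^*f)^n(x), ({}^*f)^n(y)) > c$. *)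

theory Defs
  imports "HOL-Analysis.Analysis"
begin

text \<open>
  The base set of individuals of the standard universe: the points of the space together with
  the reals; the integers and the naturals are subsets of the reals.
\<close>

datatype 'a individual = Pt 'a | Re real

text \<open>
  First-order formulas over the full structure on \<^typ>\<open>'u\<close>: every set of tuples is available as a
  relation symbol. Variables are numbered; standard parameters enter through the valuation.
  Functions are treated as graphs, and a quantifier bounded by \<open>A\<close> is a quantifier relativised to
  the unary relation \<open>{[u] | u. u \<in> A}\<close>.
\<close>

datatype 'u fm =
    Eq nat nat
  | Rel "'u list set" "nat list"
  | Neg "'u fm"
  | Conj "'u fm" "'u fm"
  | Forall nat "'u fm"

primrec sat :: "('u list set \<Rightarrow> 'w list set) \<Rightarrow> (nat \<Rightarrow> 'w) \<Rightarrow> 'u fm \<Rightarrow> bool" where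
  "sat I e (Eq i j) \<longleftrightarrow> e i = e j"
| "sat I e (Rel R is) \<longleftrightarrow> map e is \<in> I R"
| "sat I e (Neg \<phi>) \<longleftrightarrow> \<not> sat I e \<phi>"
| "sat I e (Conj \<phi> \<psi>) \<longleftrightarrow> sat I e \<phi> \<and> sat I e \<psi>"
| "sat I e (Forall i \<phi>) \<longleftrightarrow> (\<forall>a. sat I (e(i := a)) \<phi>)"

text \<open>
  \<open>emb\<close> sends a standard individual to its image and \<open>star\<close> sends a standard relation to its
  nonstandard extension.
\<close>

definition star_set :: "('u list set \<Rightarrow> 'v list set) \<Rightarrow> 'u set \<Rightarrow> 'v set" where
  "star_set star A = {v. [v] \<in> star {[u] | u. u \<in> A}}"

definition star_app :: "('u list set \<Rightarrow> 'v list set) \<Rightarrow> 'u list set \<Rightarrow> 'v list \<Rightarrow> 'v" where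
  \<comment> \<open>value at \<open>vs\<close> of the extension of the function with graph \<open>G\<close>\<close>
  "star_app star G vs = (THE w. vs @ [w] \<in> star G)"

abbreviation std_Nats :: "'a individual set" where
  "std_Nats \<equiv> range (\<lambda>n::nat. Re (of_nat n))"

abbreviation std_Ints :: "'a individual set" where
  "std_Ints \<equiv> range (\<lambda>n::int. Re (of_int n))"

locale nonstandard_extension =
  fixes emb :: "'a individual \<Rightarrow> 'v"
    and star :: "'a individual list set \<Rightarrow> 'v list set"
  assumes transfer: "\<And>e \<phi>. sat (\<lambda>R. R) e \<phi> \<longleftrightarrow> sat star (emb \<circ> e) \<phi>"
    and proper: "star_set star std_Nats \<noteq> emb ` std_Nats"

definition star_less ::
  "('a individual list set \<Rightarrow> 'v list set) \<Rightarrow> 'v \<Rightarrow> 'v \<Rightarrow> bool" where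
  "star_less star r s \<longleftrightarrow> [r, s] \<in> star {[Re a, Re b] | a b. a < b}"

definition star_dist ::
  "('a individual list set \<Rightarrow> 'v list set) \<Rightarrow> 'a set \<Rightarrow> ('a \<Rightarrow> 'a \<Rightarrow> real) \<Rightarrow> 'v \<Rightarrow> 'v \<Rightarrow> 'v" where
  "star_dist star X d p q =
     star_app star {[Pt x, Pt y, Re (d x y)] | x y. x \<in> X \<and> y \<in> X} [p, q]"

definition int_iterate :: "'a set \<Rightarrow> ('a \<Rightarrow> 'a) \<Rightarrow> int \<Rightarrow> 'a \<Rightarrow> 'a" where
  "int_iterate X f n x = (if 0 \<le> n then (f ^^ nat n) x else (inv_into X f ^^ nat (- n)) x)"

definition star_iterate ::
  "('a individual list set \<Rightarrow> 'v list set) \<Rightarrow> 'a set \<Rightarrow> ('a \<Rightarrow> 'a) \<Rightarrow> 'v \<Rightarrow> 'v \<Rightarrow> 'v" where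
  "star_iterate star X f n p =
     star_app star {[Re (of_int k), Pt x, Pt (int_iterate X f k x)] | k x. x \<in> X} [n, p]"

definition infinite_star_Ints ::
  "('a individual \<Rightarrow> 'v) \<Rightarrow> ('a individual list set \<Rightarrow> 'v list set) \<Rightarrow> 'v set" where
  "infinite_star_Ints emb star = star_set star std_Ints - emb ` std_Ints"

definition nonstandard_expansive ::
  "('a individual \<Rightarrow> 'v) \<Rightarrow> ('a individual list set \<Rightarrow> 'v list set) \<Rightarrow>
   'a set \<Rightarrow> ('a \<Rightarrow> 'a \<Rightarrow> real) \<Rightarrow> ('a \<Rightarrow> 'a) \<Rightarrow> real \<Rightarrow> bool" where
  "nonstandard_expansive emb star X d f c \<longleftrightarrow>
     (\<forall>x\<in>X. \<forall>y\<in>X. x \<noteq> y \<longrightarrow>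
        (\<exists>n \<in> infinite_star_Ints emb star.
           star_less star (emb (Re c))
             (star_dist star X d
                (star_iterate star X f n (emb (Pt x)))
                (star_iterate star X f n (emb (Pt y))))))"

end

theory Submission
  imports Defs
begin

text \<open>
  For distinct \<open>x\<close>, \<open>y\<close> let \<open>S = {n. d (f\<^sup>n x) (f\<^sup>n y) > c}\<close>. Transferring the definition of \<open>S\<close>
  shows that a hyperinteger \<open>n\<close> satisfies \<open>\<star>d ((\<star>f)\<^sup>n x) ((\<star>f)\<^sup>n y) > c\<close> exactly when it lies in the
  nonstandard extension \<open>\<star>S\<close> (\<open>mem_star_separation_times_iff\<close>). So expansiveness at \<open>x\<close>, \<open>y\<close> asks
  that \<open>\<star>S\<close> contain an infinite hyperinteger, that is, a nonstandard point. The theorem is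
  thereby reduced to a general fact, \<open>star_set_eq_image_iff_finite\<close>: a set acquires new
  points in its nonstandard extension if and only if it is infinite.

  A finite set acquires none because \<open>\<star>(A \<union> {a}) = \<star>A \<union> {a}\<close> and \<open>\<star>\<emptyset> = \<emptyset>\<close>. An infinite set \<open>A\<close>
  contains the range of an injection \<open>g : \<nat> \<rightarrow> A\<close>, and \<open>\<star>g\<close> sends an infinite hypernatural to
  a point of \<open>\<star>A\<close> that cannot be standard, since the fibres of \<open>g\<close> over standard points are finite
  and so acquire no new points.
\<close>

abbreviation Imp :: "'u fm \<Rightarrow> 'u fm \<Rightarrow> 'u fm" where
  "Imp \<phi> \<psi> \<equiv> Neg (Conj \<phi> (Neg \<psi>))"

abbreviation Iff :: "'u fm \<Rightarrow> 'u fm \<Rightarrow> 'u fm" where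
  "Iff \<phi> \<psi> \<equiv> Conj (Imp \<phi> \<psi>) (Imp \<psi> \<phi>)"

abbreviation Disj :: "'u fm \<Rightarrow> 'u fm \<Rightarrow> 'u fm" where
  "Disj \<phi> \<psi> \<equiv> Neg (Conj (Neg \<phi>) (Neg \<psi>))"

abbreviation Exists :: "nat \<Rightarrow> 'u fm \<Rightarrow> 'u fm" where
  "Exists i \<phi> \<equiv> Neg (Forall i (Neg \<phi>))"

abbreviation Mem :: "nat \<Rightarrow> 'u set \<Rightarrow> 'u fm" where
  "Mem i A \<equiv> Rel {[u] | u. u \<in> A} [i]"

context nonstandard_extension
begin

lemma emb_eq_iff: "emb a = emb b \<longleftrightarrow> a = b"
  using transfer[of "\<lambda>i. if i = 0 then a else b" "Eq 0 1"] by simp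

lemma emb_mem_star_set_iff: "emb a \<in> star_set star A \<longleftrightarrow> a \<in> A"
  using transfer[of "\<lambda>_. a" "Mem 0 A"] by (simp add: star_set_def)

lemma star_set_mono:
  assumes "A \<subseteq> B"
  shows "star_set star A \<subseteq> star_set star B"
  using transfer[of "\<lambda>_. undefined" "Forall 0 (Imp (Mem 0 A) (Mem 0 B))"] assms
  by (auto simp: star_set_def)

lemma star_set_empty: "star_set star {} = {}"
  using transfer[of "\<lambda>_. undefined" "Forall 0 (Neg (Mem 0 {}))"]
  by (simp add: star_set_def)

lemma star_set_insert: "star_set star (insert a A) = insert (emb a) (star_set star A)"
  using transfer[of "\<lambda>_. a" "Forall 0 (Iff (Mem 0 (insert a A)) (Disj (Eq 0 1) (Mem 0 A)))"]
  by (auto simp: star_set_def)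

lemma star_set_finite:
  assumes "finite A"
  shows "star_set star A = emb ` A"
  using assms by induction (simp_all add: star_set_empty star_set_insert)

text \<open>
  The properness of the extension is a statement about the naturals alone; an injective sequence in
  \<open>A\<close> carries it over to \<open>A\<close>.
\<close>

theorem star_set_eq_image_iff_finite: "star_set star A = emb ` A \<longleftrightarrow> finite A"
proof
  assume std: "star_set star A = emb ` A"
  show "finite A"
  proof (rule ccontr)
    assume "infinite A"
    then obtain g :: "nat \<Rightarrow> 'a individual" where g: "inj g" "range g \<subseteq> A"
      using infinite_countable_subset by blast
    define G where "G = {[Re (real n), g n] | n. True}"
    have "emb ` std_Nats \<subseteq> star_set star std_Nats"
      using emb_mem_star_set_iff by blast
    with proper obtain \<nu> where \<nu>: "\<nu> \<in> star_set star std_Nats" "\<nu> \<notin> emb ` std_Nats"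
      by blast
    have "\<forall>u. u \<in> std_Nats \<longrightarrow> (\<exists>a. a \<in> A \<and> [u, a] \<in> G)"
      using g(2) by (auto simp: G_def)
    then have "\<exists>a. a \<in> star_set star A \<and> [\<nu>, a] \<in> star G"
      using transfer[of "\<lambda>_. undefined"
          "Forall 0 (Imp (Mem 0 std_Nats) (Exists 1 (Conj (Mem 1 A) (Rel G [0, 1]))))"] \<nu>(1)
      by (simp add: star_set_def)
    then obtain a where a: "a \<in> A" "[\<nu>, emb a] \<in> star G"
      using std by auto
    define F :: "'a individual set" where "F = {Re (real n) | n. g n = a}"
    have "\<forall>u. [u, a] \<in> G \<longrightarrow> u \<in> F"
      by (auto simp: G_def F_def)
    then have "\<nu> \<in> star_set star F"
      using transfer[of "\<lambda>_. a" "Forall 0 (Imp (Rel G [0, 1]) (Mem 0 F))"] a(2)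
      by (simp add: star_set_def)
    moreover have "finite F"
      using finite_vimageI[OF _ g(1), of "{a}"] by (simp add: F_def vimage_def)
    ultimately have "\<nu> \<in> emb ` F"
      using star_set_finite by blast
    then show False
      using \<nu>(2) by (auto simp: F_def)
  qed
qed (rule star_set_finite)

lemma star_set_subset_image_iff_finite:
  assumes "A \<subseteq> B"
  shows "star_set star A \<subseteq> emb ` B \<longleftrightarrow> finite A"
proof -
  have "star_set star A \<subseteq> emb ` B \<longleftrightarrow> star_set star A = emb ` A"
    using assms emb_mem_star_set_iff by blast
  then show ?thesis
    by (simp add: star_set_eq_image_iff_finite)
qed

lemma star_app_eq:
  assumes "\<And>a b r s. [a, b, r] \<in> G \<Longrightarrow> [a, b, s] \<in> G \<Longrightarrow> r = s"
    and "[p, q, w] \<in> star G"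
  shows "star_app star G [p, q] = w"
proof -
  have "\<forall>a b r s. [a, b, r] \<in> star G \<longrightarrow> [a, b, s] \<in> star G \<longrightarrow> r = s"
    using transfer[of "\<lambda>_. undefined" "Forall 0 (Forall 1 (Forall 2 (Forall 3
        (Imp (Rel G [0, 1, 2]) (Imp (Rel G [0, 1, 3]) (Eq 2 3))))))"] assms(1)
    by simp
  then show ?thesis
    using assms(2) by (auto simp: star_app_def)
qed

text \<open>
  The invariance of \<open>X\<close> under all iterates keeps both orbits in the domain of the distance at each
  integer time; transfer then supplies the values at a hyperinteger time, where
  \<open>star_app_eq\<close> identifies them with the values of the extended functions.
\<close>

lemma mem_star_separation_times_iff:
  assumes invariant: "\<And>n z. z \<in> X \<Longrightarrow> int_iterate X f n z \<in> X"
    and "x \<in> X" "y \<in> X"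
    and \<nu>: "\<nu> \<in> star_set star std_Ints"
  shows "star_less star (emb (Re c))
      (star_dist star X d (star_iterate star X f \<nu> (emb (Pt x))) (star_iterate star X f \<nu> (emb (Pt y))))
    \<longleftrightarrow> \<nu> \<in> star_set star
      ((\<lambda>n. Re (of_int n)) ` {n. d (int_iterate X f n x) (int_iterate X f n y) > c})"
    (is "_ \<longleftrightarrow> \<nu> \<in> star_set star ?S")
proof -
  define G where "G = {[Re (of_int k), Pt z, Pt (int_iterate X f k z)] | k z. z \<in> X}"
  define D where "D = {[Pt z, Pt w, Re (d z w)] | z w. z \<in> X \<and> w \<in> X}"
  define L :: "'a individual list set" where "L = {[Re a, Re b] | a b. a < b}"
  have "\<forall>u. u \<in> std_Ints \<longrightarrow> (\<exists>p q r. [u, Pt x, p] \<in> G \<and> [u, Pt y, q] \<in> G \<and>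
      [p, q, r] \<in> D \<and> ([Re c, r] \<in> L \<longleftrightarrow> u \<in> ?S))"
  proof (intro allI impI)
    fix u :: "'a individual"
    assume "u \<in> std_Ints"
    then obtain k :: int where k: "u = Re (of_int k)"
      by blast
    show "\<exists>p q r. [u, Pt x, p] \<in> G \<and> [u, Pt y, q] \<in> G \<and> [p, q, r] \<in> D \<and> ([Re c, r] \<in> L \<longleftrightarrow> u \<in> ?S)"
      using assms(2,3) invariant
      by (intro exI[of _ "Pt (int_iterate X f k x)"] exI[of _ "Pt (int_iterate X f k y)"]
          exI[of _ "Re (d (int_iterate X f k x) (int_iterate X f k y))"])
        (auto simp: k G_def D_def L_def)
  qed
  then have "\<exists>p q r. [\<nu>, emb (Pt x), p] \<in> star G \<and> [\<nu>, emb (Pt y), q] \<in> star G \<and>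
      [p, q, r] \<in> star D \<and> ([emb (Re c), r] \<in> star L \<longleftrightarrow> \<nu> \<in> star_set star ?S)"
    \<comment> \<open>variables 0 to 3 are bound; 4, 5, 6 carry the parameters \<open>x\<close>, \<open>y\<close>, \<open>c\<close>\<close>
    using transfer[of "\<lambda>i. if i = 4 then Pt x else if i = 5 then Pt y else Re c"
        "Forall 0 (Imp (Mem 0 std_Ints) (Exists 1 (Exists 2 (Exists 3
          (Conj (Rel G [0, 4, 1]) (Conj (Rel G [0, 5, 2]) (Conj (Rel D [1, 2, 3])
            (Iff (Rel L [6, 3]) (Mem 0 ?S)))))))))"] \<nu>
    by (simp add: star_set_def) blast
  then obtain p q r where pqr: "[\<nu>, emb (Pt x), p] \<in> star G" "[\<nu>, emb (Pt y), q] \<in> star G"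
      "[p, q, r] \<in> star D" "[emb (Re c), r] \<in> star L \<longleftrightarrow> \<nu> \<in> star_set star ?S"
    by blast
  have G: "star_app star G [a, b] = w" if "[a, b, w] \<in> star G" for a b w
    using that by (rule star_app_eq[rotated]) (auto simp: G_def)
  have D: "star_app star D [a, b] = w" if "[a, b, w] \<in> star D" for a b w
    using that by (rule star_app_eq[rotated]) (auto simp: D_def)
  show ?thesis
    using pqr(4) G[OF pqr(1)] G[OF pqr(2)] D[OF pqr(3)]
    by (simp add: star_less_def star_dist_def star_iterate_def flip: G_def D_def L_def)
qed

end

lemma int_iterate_closed:
  assumes "bij_betw f X X" "z \<in> X"
  shows "int_iterate X f n z \<in> X"
proof -
  have "(g ^^ m) z \<in> X" if "bij_betw g X X" for g m
    using that assms(2) by (induction m) (auto dest: bij_betwE)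
  then show ?thesis
    using assms(1) bij_betw_inv_into[OF assms(1)] by (simp add: int_iterate_def)
qed

theorem theorem1:
  fixes emb :: "'a individual \<Rightarrow> 'v"
    and star :: "'a individual list set \<Rightarrow> 'v list set"
    and X :: "'a set"
    and d :: "'a \<Rightarrow> 'a \<Rightarrow> real"
    and f :: "'a \<Rightarrow> 'a"
    and c :: real
  assumes "nonstandard_extension emb star"
    and "Metric_space X d"
    and "homeomorphic_map (Metric_space.mtopology X d) (Metric_space.mtopology X d) f"
    and "c > 0"
  shows "nonstandard_expansive emb star X d f c \<longleftrightarrow>
    (\<forall>x\<in>X. \<forall>y\<in>X. x \<noteq> y \<longrightarrow>
       infinite {n::int. d (int_iterate X f n x) (int_iterate X f n y) > c})"
proof -
  interpret nonstandard_extension emb star by fact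
  interpret Metric_space X d by fact
  have "bij_betw f X X"
    using homeomorphic_imp_injective_map[OF assms(3)] homeomorphic_imp_surjective_map[OF assms(3)]
    by (simp add: bij_betw_def)
  then have invariant: "int_iterate X f n z \<in> X" if "z \<in> X" for n z
    using that by (rule int_iterate_closed)
  have "(\<exists>n \<in> infinite_star_Ints emb star. star_less star (emb (Re c))
        (star_dist star X d (star_iterate star X f n (emb (Pt x))) (star_iterate star X f n (emb (Pt y)))))
      \<longleftrightarrow> infinite {n::int. d (int_iterate X f n x) (int_iterate X f n y) > c}"
    (is "?expansive \<longleftrightarrow> infinite ?T") if "x \<in> X" "y \<in> X" for x y
  proof -
    let ?S = "(\<lambda>n. Re (of_int n)) ` ?T :: 'a individual set"
    have "?S \<subseteq> std_Ints"
      by blast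
    have "?expansive \<longleftrightarrow> (\<exists>n \<in> star_set star std_Ints - emb ` std_Ints. n \<in> star_set star ?S)"
      using mem_star_separation_times_iff[OF invariant that]
      by (auto simp: infinite_star_Ints_def)
    also have "\<dots> \<longleftrightarrow> \<not> star_set star ?S \<subseteq> emb ` std_Ints"
      using star_set_mono[OF \<open>?S \<subseteq> std_Ints\<close>] by blast
    also have "\<dots> \<longleftrightarrow> infinite ?S"
      using star_set_subset_image_iff_finite[OF \<open>?S \<subseteq> std_Ints\<close>] by simp
    also have "\<dots> \<longleftrightarrow> infinite ?T"
      by (simp add: finite_image_iff inj_on_def)
    finally show ?thesis .
  qed
  then show ?thesis
    by (simp add: nonstandard_expansive_def)
qed

end
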